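(* For every sufficiently large $k\in\mathbb{N}$, and every admissible choice of the intervals $P(J)$ in the construction described in the context, the following holds. Let $r=1+\frac{1}{3^{k+1}}$. Then for every $l\in\mathbb{N}$, every $I\in\mathcal{I}_l$ and all $x\in I^{\Delta}$, $$M_rw_k(x)\le 21\,w_k(x).$$
   Context: For $r>1$, $M_rf(x)=\sup_{R\ni x}\left(\frac{1}{|R|}\int_R|f(y)|^r\,dy\right)^{1/r}$, the supremum being over all bounded intervals $R\subset\mathbb{R}$ containing $x$. A triadic interval is an interval of the form $[3^jn,3^j(n+1))$ with $j,n\in\mathbb{Z}$. Fix $k\in\mathbb{N}$ large enough. For a triadic interval $I\subset[0,1)$, let $I^{\Delta}$ be the interval with the same center as $I$ and one third of its length (the middle triadic third of $I$), and let $P(I)$ be a triadic interval adjacent to $I^{\Delta}$ (lying outside $I^\Delta$, inside $I$) with $|P(I)|=3^{-k}|I|$; $P(I)$ may be situated either immediately to the left or immediately to the right of $I^\Delta$, and one such choice is made for each interval. Construction. Let $\mathcal{J}_1=\{[0,1)\}$. Inductively, for $l\ge 2$, let $\mathcal{J}_l$ be the family of all intervals obtained by subdividing, for each $J\in\mathcal{J}_{l-1}$, the interval $J^{\Delta}$ into $3^{k-1}$ triadic intervals of equal length. Thus $\mathcal{J}_l$ consists of $3^{(k-1)(l-1)}$ intervals, each of length $3^{-(l-1)k}$. Let $\mathcal{I}_l=\{P(J):J\in\mathcal{J}_l\}$; its intervals have length $3^{-lk}$, and all intervals in $\bigcup_l\mathcal{I}_l$ are pairwise disjoint. Put $\Omega_l=\bigcup_{I\in\mathcal{I}_l}I$.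 The weight $w_k$ (a non-negative measurable function) is the one that vanishes outside $\bigcup_{l\ge1}\Omega_l$ and satisfies: $w_k([0,1])=1$; for each $l\ge1$, $w_k$ is constant on $\Omega_l$; and for every $l\ge 1$, $I\in\mathcal{I}_l$ and $J\in\mathcal{J}_{l+1}$ one has $w_k(I)=w_k(J)$. Here $w_k(E)=\int_E w_k\,dx$. *)

theory Defs
  imports "HOL-Analysis.Analysis"
begin

definition len :: "real set \<Rightarrow> real" where
  "len R = measure lebesgue R"

text \<open>Used only for positive exponents, so that infinity is mapped to infinity.\<close>

definition ennreal_powr :: "ennreal \<Rightarrow> real \<Rightarrow> ennreal" where
  "ennreal_powr a p = (if a = top then top else ennreal (enn2real a powr p))"

text \<open>The values are extended non-negative reals, so that neither the integrals nor the
  supremum need a finiteness assumption. Degenerate intervals are excluded, since the average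
  over them makes no sense.\<close>

definition maximal_fn :: "real \<Rightarrow> (real \<Rightarrow> real) \<Rightarrow> real \<Rightarrow> ennreal" where
  "maximal_fn r f x =
     (SUP R \<in> {R. is_interval R \<and> bounded R \<and> 0 < len R \<and> x \<in> R}.
        ennreal_powr ((\<integral>\<^sup>+y\<in>R. ennreal (\<bar>f y\<bar> powr r) \<partial>lebesgue) / ennreal (len R)) (1 / r))"

definition weight_of :: "(real \<Rightarrow> real) \<Rightarrow> real set \<Rightarrow> ennreal" where
  "weight_of w E = (\<integral>\<^sup>+x\<in>E. ennreal (w x) \<partial>lebesgue)"

definition triadic :: "real set \<Rightarrow> bool" where
  "triadic I \<longleftrightarrow>
     (\<exists>j n :: int. I = {3 powi j * of_int n ..< 3 powi j * (of_int n + 1)})"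

text \<open>For \<open>I = [a, b)\<close>, so that \<open>Inf I = a\<close> and \<open>Sup I = b\<close>, this is the interval
  \<open>[a + (b - a)/3, b - (b - a)/3)\<close>.\<close>

definition middle_third :: "real set \<Rightarrow> real set" where
  "middle_third I =
     {Inf I + (Sup I - Inf I) / 3 ..< Sup I - (Sup I - Inf I) / 3}"

text \<open>A choice of the intervals \<open>P(I)\<close>. The last conjunct says that \<open>P(I)\<close> lies immediately to
  the left or immediately to the right of the middle third; the side may depend on \<open>I\<close>.\<close>

definition admissible_choice :: "nat \<Rightarrow> (real set \<Rightarrow> real set) \<Rightarrow> bool" where
  "admissible_choice k P \<longleftrightarrow>
     (\<forall>I. triadic I \<and> I \<subseteq> {0..<1} \<longrightarrow>
        triadic (P I) \<and> len (P I) = len I / 3 ^ k \<and>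
        P I \<subseteq> I \<and> P I \<inter> middle_third I = {} \<and>
        (Sup (P I) = Inf (middle_third I) \<or> Inf (P I) = Sup (middle_third I)))"

text \<open>The families are indexed from \<open>1\<close>; the value at \<open>0\<close> is a dummy. The triadic intervals
  contained in \<open>J\<^sup>\<Delta>\<close> and of length \<open>|J\<^sup>\<Delta>| / 3 ^ (k - 1)\<close> are exactly the pieces of the
  subdivision of \<open>J\<^sup>\<Delta>\<close> into \<open>3 ^ (k - 1)\<close> triadic intervals of equal length, if
  \<open>k \<ge> 1\<close> and \<open>J\<close> is triadic.\<close>

fun J_fam :: "nat \<Rightarrow> nat \<Rightarrow> real set set" where
  "J_fam k 0 = {}"
| "J_fam k (Suc 0) = {{0..<1}}"
| "J_fam k (Suc (Suc l)) =
     (\<Union>J \<in> J_fam k (Suc l).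
        {K. triadic K \<and> K \<subseteq> middle_third J \<and> len K = len (middle_third J) / 3 ^ (k - 1)})"

definition I_fam :: "nat \<Rightarrow> (real set \<Rightarrow> real set) \<Rightarrow> nat \<Rightarrow> real set set" where
  "I_fam k P l = P ` J_fam k l"

definition Omega :: "nat \<Rightarrow> (real set \<Rightarrow> real set) \<Rightarrow> nat \<Rightarrow> real set" where
  "Omega k P l = \<Union> (I_fam k P l)"

text \<open>These conditions determine \<open>w\<close> pointwise: they force \<open>w = (3 ^ k / (3 ^ (k - 1) + 1)) ^ l\<close>
  on \<open>\<Omega>\<^sub>l\<close>.\<close>

definition is_weight :: "nat \<Rightarrow> (real set \<Rightarrow> real set) \<Rightarrow> (real \<Rightarrow> real) \<Rightarrow> bool" where
  "is_weight k P w \<longleftrightarrow>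
     w \<in> borel_measurable lebesgue \<and> (\<forall>x. 0 \<le> w x) \<and>
     (\<forall>x. x \<notin> (\<Union>l\<in>{1..}. Omega k P l) \<longrightarrow> w x = 0) \<and>
     weight_of w {0..1} = 1 \<and>
     (\<forall>l\<ge>1. w constant_on Omega k P l) \<and>
     (\<forall>l\<ge>1. \<forall>I \<in> I_fam k P l. \<forall>J \<in> J_fam k (l + 1). weight_of w I = weight_of w J)"

end

theory Submission
  imports Defs
begin

text \<open>
  The weight is explicit. Every \<open>J\<close> of generation \<open>l\<close> splits its mass equally among the
  \<open>3 ^ (k - 1)\<close> intervals of generation \<open>l + 1\<close> inside it and the interval \<open>P J\<close>, all of
  length \<open>|J| / 3 ^ k\<close>; hence \<open>w = \<alpha> ^ l\<close> on \<open>\<Omega>\<^sub>l\<close>, where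
  \<open>\<alpha> = 3 ^ k / (3 ^ (k - 1) + 1)\<close> lies below \<open>3\<close> (\<open>w_Omega\<close>). Put \<open>\<beta> = \<alpha> ^ r\<close>.

  The part of \<open>\<Omega>\<^sub>i\<close> inside one \<open>J\<close> shrinks by the factor \<open>3\<close> when \<open>i\<close> grows by one, while
  \<open>w ^ r\<close> grows there by the factor \<open>\<beta>\<close>. The integral of \<open>w ^ r\<close> over \<open>J\<close> is therefore a
  geometric series of ratio \<open>\<beta> / 3\<close>. The exponent \<open>r\<close> is so close to \<open>1\<close> that
  \<open>1 - \<beta> / 3\<close> is still comparable to \<open>3 ^ (- k)\<close>, and this loss of a factor \<open>3 ^ k\<close>
  is compensated exactly by \<open>|P J| = |J| / 3 ^ k\<close>: the mean of \<open>w ^ r\<close> over \<open>J\<close> is at most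
  \<open>6 / 7 * \<beta> ^ l\<close>, of the order of the value of \<open>w ^ r\<close> on \<open>P J\<close> (\<open>w_powr_integral_J\<close>).

  Let \<open>x\<close> be in the middle third of \<open>I \<in> \<I>\<^sub>l\<close> and let \<open>R\<close> be an interval through \<open>x\<close>. If
  \<open>R \<subseteq> I\<close>, then \<open>w\<close> is constant on \<open>R\<close>. Otherwise \<open>|R| \<ge> |I| / 3\<close>, and this alone
  suffices: outside the intervals of generation \<open>l + 1\<close> one has
  \<open>w ^ r \<le> \<beta> ^ l\<close> everywhere, and those intervals of generation \<open>l + 1\<close> that meet \<open>R\<close>, which
  have the same length as \<open>I\<close>, have total length at most \<open>|R| + 2 |I| \<le> 7 |R|\<close>. So the mean of
  \<open>w ^ r\<close> over \<open>R\<close> is at most \<open>\<beta> ^ l * (1 + 7 * 6 / 7 * \<beta>) \<le> 19 * \<beta> ^ l\<close>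
  (\<open>w_powr_integral_long_interval\<close>). Every \<open>k \<ge> 1\<close> is large enough for these estimates.
\<close>

section \<open>Triadic cells\<close>

text \<open>Intervals of the construction never get longer than \<open>1\<close>, so natural exponents suffice, and the
  length of a triadic interval determines its exponent (\<open>triadic_eq_cell\<close> below). With a fixed
  \<open>N\<close>, membership is the equation \<open>mem_cell_iff\<close>, which makes disjointness immediate.\<close>

definition cell :: "nat \<Rightarrow> int \<Rightarrow> real set" where
  "cell N n = {of_int n / 3 ^ N ..< (of_int n + 1) / 3 ^ N}"

lemma mem_cell_iff: "x \<in> cell N n \<longleftrightarrow> \<lfloor>x * 3 ^ N\<rfloor> = n"
  by (simp add: cell_def floor_eq_iff field_simps)

lemma cell_nonempty: "cell N n \<noteq> {}"
  by (simp add: cell_def divide_strict_right_mono)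

lemma disjoint_cells: "n \<noteq> m \<Longrightarrow> cell N n \<inter> cell N m = {}"
  by (auto simp: mem_cell_iff)

lemma inj_cell: "inj (cell N)"
  using cell_nonempty disjoint_cells unfolding inj_def by (metis Int_absorb)

lemma cell_measurable [measurable, simp]: "cell N n \<in> sets lebesgue"
  by (simp add: cell_def)

lemma emeasure_cell: "emeasure lebesgue (cell N n) = ennreal (1 / 3 ^ N)"
proof -
  have "real_of_int n / 3 ^ N \<le> (real_of_int n + 1) / 3 ^ N"
    by (simp add: divide_right_mono)
  moreover have "(real_of_int n + 1) / 3 ^ N - real_of_int n / 3 ^ N = 1 / 3 ^ N"
    by (simp add: diff_divide_distrib [symmetric])
  ultimately show ?thesis
    by (simp add: cell_def)
qed

lemma len_cell: "len (cell N n) = 1 / 3 ^ N"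
  by (simp add: len_def measure_def emeasure_cell)

lemma Inf_cell: "Inf (cell N n) = of_int n / 3 ^ N"
  and Sup_cell: "Sup (cell N n) = (of_int n + 1) / 3 ^ N"
  by (simp_all add: cell_def divide_strict_right_mono cInf_atLeastLessThan cSup_atLeastLessThan)

lemma triadic_cell: "triadic (cell N n)"
  unfolding triadic_def cell_def
  by (intro exI[of _ "- int N"] exI[of _ n]) (simp add: power_int_minus field_simps)

lemma triadic_eq_cell:
  assumes "triadic I" "len I = 1 / 3 ^ N"
  obtains n where "I = cell N n"
proof -
  obtain j n :: int where I: "I = {3 powi j * of_int n ..< 3 powi j * (of_int n + 1)}"
    using assms(1) by (auto simp: triadic_def)
  have "len I = (3::real) powi j"
    unfolding I len_def by (subst measure_lborel_Ico | simp add: algebra_simps)+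
  then have "(3::real) powi j = 3 powi (- int N)"
    using assms(2) by (simp add: power_int_minus field_simps)
  then have "j = - int N"
    by (metis less_irrefl linorder_neqE one_less_numeral_iff power_int_strict_increasing semiring_norm(77))
  then show ?thesis
    using that[of n] by (simp add: I cell_def power_int_minus field_simps)
qed

lemma middle_third_cell: "middle_third (cell N n) = cell (Suc N) (3 * n + 1)"
proof -
  have len: "Sup (cell N n) - Inf (cell N n) = 1 / 3 ^ N"
    by (simp add: Inf_cell Sup_cell add_divide_distrib)
  have "real_of_int n / 3 ^ N + 1 / 3 ^ N / 3 = of_int (3 * n + 1) / 3 ^ Suc N"
    and "(real_of_int n + 1) / 3 ^ N - 1 / 3 ^ N / 3 = (of_int (3 * n + 1) + 1) / 3 ^ Suc N"
    by (simp_all add: field_simps)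
  then show ?thesis
    unfolding middle_third_def len by (simp only: Inf_cell Sup_cell) (simp only: cell_def)
qed

lemma cell_subset_iff: "cell (N + d) m \<subseteq> cell N n \<longleftrightarrow> 3 ^ d * n \<le> m \<and> m < 3 ^ d * (n + 1)"
proof -
  have "cell (N + d) m \<subseteq> cell N n \<longleftrightarrow>
        of_int n / 3 ^ N \<le> real_of_int m / 3 ^ (N + d) \<and>
        (real_of_int m + 1) / 3 ^ (N + d) \<le> (of_int n + 1) / 3 ^ N"
    using cell_nonempty[of "N + d" m] 
    by (auto simp: cell_def dest!: atLeastLessThan_subset_iff)
  also have "\<dots> \<longleftrightarrow> real_of_int (3 ^ d * n) \<le> of_int m \<and> real_of_int (m + 1) \<le> of_int (3 ^ d * (n + 1))"
  proof -
    have "of_int n / 3 ^ N = real_of_int (3 ^ d * n) / 3 ^ (N + d)"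
      and "(of_int n + 1) / 3 ^ N = real_of_int (3 ^ d * (n + 1)) / 3 ^ (N + d)"
      by (simp_all add: power_add)
    then show ?thesis by (simp only: divide_le_cancel) simp
  qed
  also have "\<dots> \<longleftrightarrow> 3 ^ d * n \<le> m \<and> m < 3 ^ d * (n + 1)"
    unfolding of_int_le_iff by linarith
  finally show ?thesis .
qed

lemma diff_le_len:
  assumes "is_interval R" "R \<in> lmeasurable" "x \<in> R" "y \<in> R"
  shows "y - x \<le> len R"
proof (cases "x \<le> y")
  case True
  have "{x..y} \<subseteq> R"
    using assms by (meson atLeastAtMost_iff is_interval_1 subsetI)
  then have "measure lebesgue {x..y} \<le> len R"
    unfolding len_def using assms(2) by (intro measure_mono_fmeasurable) auto
  then show ?thesis using True by simp
next
  case False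
  moreover have "0 \<le> len R" by (simp add: len_def)
  ultimately show ?thesis by linarith
qed

text \<open>All cells that meet \<open>R\<close>, apart from the first and the last, lie between a point of \<open>R\<close> in the
  first cell and a point of \<open>R\<close> in the last one.\<close>

lemma card_cells_meeting_interval:
  assumes "finite S" "is_interval R" "R \<in> lmeasurable"
    and meet: "\<And>n. n \<in> S \<Longrightarrow> cell N n \<inter> R \<noteq> {}"
  shows "real (card S) / 3 ^ N \<le> len R + 2 / 3 ^ N"
proof (cases "S = {}")
  case True
  then show ?thesis by (simp add: len_def)
next
  case False
  define p q where "p = Min S" and "q = Max S"
  have "p \<in> S" "q \<in> S" using assms(1) False by (auto simp: p_def q_def)
  then obtain x y where x: "x \<in> cell N p" "x \<in> R" and y: "y \<in> cell N q" "y \<in> R"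
    using meet by blast
  have "S \<subseteq> {p..q}" using assms(1) by (auto simp: p_def q_def)
  then have "card S \<le> card {p..q}" by (intro card_mono) auto
  moreover have "p \<le> q" using \<open>p \<in> S\<close> \<open>S \<subseteq> {p..q}\<close> by auto
  ultimately have card: "real (card S) \<le> of_int q - of_int p + 1" by simp
  have "y - x \<le> len R"
    using diff_le_len assms(2,3) x(2) y(2) by blast
  moreover have "x < (of_int p + 1) / 3 ^ N" "of_int q / 3 ^ N \<le> y"
    using x y by (auto simp: cell_def)
  ultimately have "of_int q / 3 ^ N - (of_int p + 1) / 3 ^ N \<le> len R"
    by linarith
  moreover have "real (card S) / 3 ^ N \<le> (of_int q - of_int p + 1) / 3 ^ N"
    using card by (simp add: divide_right_mono)
  ultimately show ?thesis
    by (simp add: add_divide_distrib diff_divide_distrib)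
qed

section \<open>The tree of intervals\<close>

definition children :: "nat \<Rightarrow> real set \<Rightarrow> real set set" where
  "children k J =
     {K. triadic K \<and> K \<subseteq> middle_third J \<and> len K = len (middle_third J) / 3 ^ (k - 1)}"

lemma J_fam_children: "J_fam k (Suc (Suc l)) = \<Union> (children k ` J_fam k (Suc l))"
  by (simp add: children_def J_fam.simps(3))

lemma children_cell:
  assumes "k \<ge> 1"
  shows "children k (cell N n) = cell (N + k) ` {3 ^ (k - 1) * (3 * n + 1) ..< 3 ^ (k - 1) * (3 * n + 2)}"
proof -
  have k: "N + k = Suc N + (k - 1)" using assms by simp
  have len: "len (middle_third (cell N n)) / 3 ^ (k - 1) = 1 / 3 ^ (N + k)"
    unfolding k by (simp add: middle_third_cell len_cell power_add)
  have sub: "cell (N + k) m \<subseteq> middle_third (cell N n) \<longleftrightarrow>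
    m \<in> {3 ^ (k - 1) * (3 * n + 1) ..< 3 ^ (k - 1) * (3 * n + 2)}" for m
    unfolding k middle_third_cell cell_subset_iff by (auto simp: algebra_simps)
  show ?thesis
  proof (intro equalityI subsetI)
    fix K assume "K \<in> children k (cell N n)"
    then have K: "triadic K" "K \<subseteq> middle_third (cell N n)" "len K = 1 / 3 ^ (N + k)"
      using len by (auto simp: children_def)
    obtain m where "K = cell (N + k) m" using triadic_eq_cell[OF K(1,3)] .
    then show "K \<in> cell (N + k) ` {3 ^ (k - 1) * (3 * n + 1) ..< 3 ^ (k - 1) * (3 * n + 2)}"
      using K(2) sub by blast
  next
    fix K assume "K \<in> cell (N + k) ` {3 ^ (k - 1) * (3 * n + 1) ..< 3 ^ (k - 1) * (3 * n + 2)}"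
    then obtain m where m: "K = cell (N + k) m" "K \<subseteq> middle_third (cell N n)"
      using sub by blast
    then have "len K = len (middle_third (cell N n)) / 3 ^ (k - 1)"
      using len by (simp add: len_cell)
    then show "K \<in> children k (cell N n)"
      using m triadic_cell by (simp add: children_def)
  qed
qed

declare J_fam.simps(3) [simp del]

locale triadic_construction =
  fixes k :: nat and P :: "real set \<Rightarrow> real set"
  assumes k: "k \<ge> 1" and admissible: "admissible_choice k P"
begin

lemma J_fam_cell:
  "J \<in> J_fam k (Suc l) \<Longrightarrow> \<exists>n. J = cell (l * k) n \<and> J \<subseteq> {0..<1}"
proof (induction l arbitrary: J)
  case 0
  then show ?case by (auto intro!: exI[of _ 0] simp: cell_def)
next
  case (Suc l)
  then obtain J' where J': "J' \<in> J_fam k (Suc l)" "J \<in> children k J'"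
    by (auto simp: J_fam_children)
  obtain n where n: "J' = cell (l * k) n" "J' \<subseteq> {0..<1}" using Suc.IH[OF J'(1)] by blast
  have "J \<subseteq> middle_third J'" using J'(2) by (simp add: children_def)
  also have "\<dots> \<subseteq> J'"
    using cell_subset_iff[of "l * k" 1 "3 * n + 1" n] by (simp add: n(1) middle_third_cell)
  finally show ?case
    using J'(2) n children_cell[OF k] by (auto simp: add.commute)
qed

lemma J_fam_measurable: "J \<in> J_fam k (Suc l) \<Longrightarrow> J \<in> sets lebesgue"
  using J_fam_cell[of J l] by auto

lemma finite_children: "J \<in> J_fam k (Suc l) \<Longrightarrow> finite (children k J)"
  using J_fam_cell[of J l] children_cell[OF k] by auto

lemma card_children: "J \<in> J_fam k (Suc l) \<Longrightarrow> card (children k J) = 3 ^ (k - 1)"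
proof -
  assume "J \<in> J_fam k (Suc l)"
  then obtain n where n: "J = cell (l * k) n" using J_fam_cell by blast
  have "card (children k J) = nat (3 ^ (k - 1) * (3 * n + 2) - 3 ^ (k - 1) * (3 * n + 1))"
    unfolding n children_cell[OF k]
    by (subst card_image) (auto intro: inj_on_subset[OF inj_cell])
  also have "3 ^ (k - 1) * (3 * n + 2) - 3 ^ (k - 1) * (3 * n + 1) = int (3 ^ (k - 1))"
    by (simp add: algebra_simps)
  finally show ?thesis by simp
qed

lemma children_J_fam:
  "J \<in> J_fam k (Suc l) \<Longrightarrow> K \<in> children k J \<Longrightarrow> K \<in> J_fam k (Suc (Suc l))"
  by (auto simp: J_fam_children)

lemma finite_J_fam: "finite (J_fam k (Suc l))"
  by (induction l) (auto simp: J_fam_children intro: finite_children)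

lemma J_fam_disjoint:
  assumes "J \<in> J_fam k (Suc l)" "J' \<in> J_fam k (Suc l)" "x \<in> J" "x \<in> J'"
  shows "J = J'"
  using J_fam_cell[OF assms(1)] J_fam_cell[OF assms(2)] assms(3,4) by (auto simp: mem_cell_iff)

lemma middle_third_subset: "J \<in> J_fam k (Suc l) \<Longrightarrow> middle_third J \<subseteq> J"
proof -
  assume "J \<in> J_fam k (Suc l)"
  then obtain n where n: "J = cell (l * k) n" using J_fam_cell by blast
  show ?thesis
    using cell_subset_iff[of "l * k" 1 "3 * n + 1" n] by (simp add: n middle_third_cell)
qed

lemma P_cell:
  assumes "J \<in> J_fam k (Suc l)"
  shows "\<exists>n. P J = cell (Suc l * k) n" "P J \<subseteq> J" "P J \<inter> middle_third J = {}"
proof -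
  obtain n where n: "J = cell (l * k) n" "J \<subseteq> {0..<1}" using J_fam_cell[OF assms] by blast
  then have PJ: "triadic (P J) \<and> len (P J) = len J / 3 ^ k \<and> P J \<subseteq> J \<and> P J \<inter> middle_third J = {}"
    using admissible triadic_cell unfolding admissible_choice_def by blast
  then show "P J \<subseteq> J" "P J \<inter> middle_third J = {}" by auto
  have "len (P J) = 1 / 3 ^ (Suc l * k)"
    using PJ by (simp add: n len_cell power_add)
  then show "\<exists>n. P J = cell (Suc l * k) n" using PJ triadic_eq_cell by metis
qed

lemma J_fam_ancestor:
  "K \<in> J_fam k (Suc (l + d)) \<Longrightarrow> \<exists>J \<in> J_fam k (Suc l). K \<subseteq> J"
proof (induction d arbitrary: K)
  case (Suc d)
  then obtain J' where J': "J' \<in> J_fam k (Suc (l + d))" "K \<in> children k J'"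
    by (auto simp: J_fam_children)
  then have "K \<subseteq> J'"
    using middle_third_subset[OF J'(1)] by (auto simp: children_def)
  then show ?case using Suc.IH[OF J'(1)] by blast
qed auto

lemma Omega_mem:
  "x \<in> Omega k P (Suc l) \<longleftrightarrow> (\<exists>J \<in> J_fam k (Suc l). x \<in> P J)"
  by (auto simp: Omega_def I_fam_def)

lemma Omega_measurable [measurable]: "Omega k P (Suc l) \<in> sets lebesgue"
proof -
  have "P J \<in> sets lebesgue" if "J \<in> J_fam k (Suc l)" for J
    using P_cell(1)[OF that] by auto
  then show ?thesis
    unfolding Omega_def I_fam_def by (intro sets.finite_Union finite_imageI finite_J_fam) auto
qed

lemma Omega_in_earlier_J:
  assumes "x \<in> Omega k P (Suc i)" "l \<le> i"
  shows "\<exists>J \<in> J_fam k (Suc l). x \<in> J"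
proof -
  obtain J where "J \<in> J_fam k (Suc i)" "x \<in> P J" using assms by (auto simp: Omega_mem)
  then show ?thesis
    using J_fam_ancestor[of J l "i - l"] P_cell(2)[of J i] assms(2) by auto
qed

text \<open>Later generations live in the middle thirds of earlier ones, which \<open>P\<close> avoids.\<close>

lemma earlier_Omega_Int_J_empty:
  assumes "J \<in> J_fam k (Suc l)" "i < l"
  shows "Omega k P (Suc i) \<inter> J = {}"
proof (rule ccontr)
  assume "Omega k P (Suc i) \<inter> J \<noteq> {}"
  then obtain x J' where x: "x \<in> J" and J': "J' \<in> J_fam k (Suc i)" "x \<in> P J'"
    by (auto simp: Omega_mem)
  obtain K where K: "K \<in> J_fam k (Suc (Suc i))" "J \<subseteq> K"
    using J_fam_ancestor[of J "Suc i" "l - Suc i"] assms by auto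
  then obtain J'' where J'': "J'' \<in> J_fam k (Suc i)" "K \<in> children k J''"
    by (auto simp: J_fam_children)
  then have mid: "x \<in> middle_third J''" using x K(2) by (auto simp: children_def)
  have "x \<in> J'" "x \<in> J''"
    using mid middle_third_subset[OF J''(1)] P_cell(2)[OF J'(1)] J'(2) by blast+
  then have "J' = J''" using J_fam_disjoint[OF J'(1) J''(1)] by blast
  then show False using mid J'(2) P_cell(3)[OF J'(1)] by auto
qed

lemma Omega_Int_J_eq_P:
  assumes "J \<in> J_fam k (Suc l)"
  shows "Omega k P (Suc l) \<inter> J = P J"
proof -
  have "x \<in> P J" if x: "x \<in> Omega k P (Suc l)" "x \<in> J" for x
  proof -
    obtain J' where J': "J' \<in> J_fam k (Suc l)" "x \<in> P J'"
      using x(1) unfolding Omega_mem by (elim bexE)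
    then have "x \<in> J'" using P_cell(2) by blast
    then have "J' = J" using J_fam_disjoint[OF J'(1) assms] x(2) by simp
    then show ?thesis using J'(2) by simp
  qed
  moreover have "P J \<subseteq> Omega k P (Suc l)"
    using assms by (auto simp: Omega_mem)
  ultimately show ?thesis using P_cell(2)[OF assms] by blast
qed

text \<open>Since \<open>\<Omega>\<^sub>i\<close> lies inside the intervals of each generation up to \<open>i\<close>, and intervals of one
  generation are disjoint, a point of \<open>\<Omega>\<^sub>i \<inter> J\<close> with \<open>i\<close> later than \<open>J\<close> must lie in a child
  of \<open>J\<close> itself.\<close>

lemma later_Omega_Int_J_subset:
  assumes "J \<in> J_fam k (Suc l)" "l < i"
  shows "Omega k P (Suc i) \<inter> J \<subseteq> \<Union> (children k J)"
proof
  fix x assume x: "x \<in> Omega k P (Suc i) \<inter> J"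
  obtain K where K: "K \<in> J_fam k (Suc (Suc l))" "x \<in> K"
    using Omega_in_earlier_J[of x i "Suc l"] x assms by auto
  then obtain J' where J': "J' \<in> J_fam k (Suc l)" "K \<in> children k J'"
    by (auto simp: J_fam_children)
  then have "x \<in> J'" using K(2) middle_third_subset[OF J'(1)] by (auto simp: children_def)
  then have "J' = J" using J_fam_disjoint[OF J'(1) assms(1)] x by blast
  then show "x \<in> \<Union> (children k J)" using J' K by blast
qed

text \<open>Each generation multiplies the number of intervals by \<open>3 ^ (k - 1)\<close> and their lengths by
  \<open>3 ^ (- k)\<close>, so the measure drops by the factor \<open>3\<close>.\<close>

lemma emeasure_Omega_Int_J_le:
  assumes "K \<in> J_fam k (Suc m)"
  shows "emeasure lebesgue (Omega k P (Suc (m + j)) \<inter> K) \<le> ennreal ((1 / 3) ^ j / 3 ^ (Suc m * k))"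
  using assms
proof (induction j arbitrary: m K)
  case 0
  obtain n where "P K = cell (Suc m * k) n" using P_cell(1)[OF 0] by blast
  then show ?case using Omega_Int_J_eq_P[OF 0] emeasure_cell by simp
next
  case (Suc j)
  let ?O = "Omega k P (Suc (m + Suc j))"
  have "?O \<inter> K \<subseteq> (\<Union>K' \<in> children k K. ?O \<inter> K')"
    using later_Omega_Int_J_subset[OF Suc.prems, of "m + Suc j"] by auto
  moreover have meas: "?O \<inter> K' \<in> sets lebesgue" if "K' \<in> children k K" for K'
    using children_J_fam[OF Suc.prems that] J_fam_measurable[of K' "Suc m"] by auto
  ultimately have "emeasure lebesgue (?O \<inter> K) \<le> emeasure lebesgue (\<Union>K' \<in> children k K. ?O \<inter> K')"
    using finite_children[OF Suc.prems] by (intro emeasure_mono sets.finite_UN) auto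
  also have "\<dots> \<le> (\<Sum>K' \<in> children k K. emeasure lebesgue (?O \<inter> K'))"
    using meas finite_children[OF Suc.prems] by (intro emeasure_subadditive_finite) auto
  also have "\<dots> \<le> (\<Sum>K' \<in> children k K. ennreal ((1 / 3) ^ j / 3 ^ (Suc (Suc m) * k)))"
    using Suc.IH[OF children_J_fam[OF Suc.prems]] by (intro sum_mono) simp
  also have "\<dots> = ennreal (3 ^ (k - 1) * ((1 / 3) ^ j / 3 ^ (Suc (Suc m) * k)))"
    by (simp add: card_children[OF Suc.prems] ennreal_of_nat_eq_real_of_nat flip: ennreal_mult)
  also have "3 ^ (k - 1) * ((1 / 3) ^ j / 3 ^ (Suc (Suc m) * k)) = (1 / 3 :: real) ^ Suc j / 3 ^ (Suc m * k)"
  proof -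
    have "(3::real) ^ k = 3 * 3 ^ (k - 1)" using k by (cases k) auto
    then have *: "(3::real) ^ (Suc (Suc m) * k) = 3 * 3 ^ (k - 1) * 3 ^ (Suc m * k)"
      by (simp add: power_add)
    have "A * (x / (3 * A * B)) = x * (1 / 3) / B" if "A > 0" for A B x :: real
      using that by simp
    from this[of "3 ^ (k - 1)"] show ?thesis unfolding * by simp
  qed
  finally show ?case .
qed

end

section \<open>Values of the weight\<close>

locale triadic_weight = triadic_construction +
  fixes w :: "real \<Rightarrow> real"
  assumes weight: "is_weight k P w"
begin

lemma w_measurable [measurable]: "w \<in> borel_measurable lebesgue"
  and w_nonneg: "0 \<le> w x"
  and weight_unit: "weight_of w {0..1} = 1"
  using weight by (auto simp: is_weight_def)

lemma w_support: "w x \<noteq> 0 \<Longrightarrow> \<exists>i. x \<in> Omega k P (Suc i)"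
proof -
  assume "w x \<noteq> 0"
  then have "x \<in> (\<Union>l\<in>{1..}. Omega k P l)" using weight unfolding is_weight_def by blast
  then obtain l where "l \<ge> 1" "x \<in> Omega k P l" by auto
  then show ?thesis by (intro exI[of _ "l - 1"]) simp
qed

lemma weight_P_eq_weight_child:
  assumes "J \<in> J_fam k (Suc l)" "K \<in> children k J"
  shows "weight_of w (P J) = weight_of w K"
  using weight assms children_J_fam[OF assms] unfolding is_weight_def I_fam_def by fastforce

text \<open>Up to points where \<open>w\<close> vanishes, \<open>J\<close> is the disjoint union of \<open>P J\<close> and the children of
  \<open>J\<close>, by the three lemmas on the position of \<open>J\<close> relative to the sets \<open>\<Omega>\<^sub>i\<close>.\<close>

lemma weight_split:
  assumes J: "J \<in> J_fam k (Suc l)"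
  shows "weight_of w J = weight_of w (P J) + (\<Sum>K \<in> children k J. weight_of w K)"
proof -
  have U: "\<Union> (children k J) \<subseteq> middle_third J" by (auto simp: children_def)
  have disj: "disjoint_family_on (\<lambda>K. K) (children k J)"
    unfolding disjoint_family_on_def using J_fam_disjoint[OF children_J_fam[OF J] children_J_fam[OF J]] by blast
  have pointwise: "ennreal (w x) * indicator J x =
      ennreal (w x) * indicator (P J) x + (\<Sum>K \<in> children k J. ennreal (w x) * indicator K x)" for x
  proof (cases "w x = 0")
    case False
    then obtain i where i: "x \<in> Omega k P (Suc i)" using w_support by blast
    have "x \<in> J \<longleftrightarrow> x \<in> P J \<or> x \<in> \<Union> (children k J)"
    proof
      assume x: "x \<in> J"
      consider "i < l" | "i = l" | "l < i" by linarith
      then show "x \<in> P J \<or> x \<in> \<Union> (children k J)"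
      proof cases
        case 1
        then show ?thesis using earlier_Omega_Int_J_empty[OF J] i x by blast
      next
        case 2
        then show ?thesis using Omega_Int_J_eq_P[OF J] i x by blast
      next
        case 3
        then show ?thesis using later_Omega_Int_J_subset[OF J] i x by blast
      qed
    qed (use U P_cell(2)[OF J] middle_third_subset[OF J] in blast)
    moreover have "\<not> (x \<in> P J \<and> x \<in> \<Union> (children k J))" using U P_cell(3)[OF J] by blast
    ultimately have "indicator J x = indicator (P J) x + (indicator (\<Union> (children k J)) x :: ennreal)"
      by (auto simp: indicator_def)
    also have "indicator (\<Union> (children k J)) x = (\<Sum>K \<in> children k J. indicator K x :: ennreal)"
      using indicator_UN_disjoint[OF finite_children[OF J] disj, of x] by simp
    finally show ?thesis by (simp add: distrib_left sum_distrib_left)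
  qed simp
  have [measurable]: "P J \<in> sets lebesgue" using P_cell(1)[OF J] by auto
  have [measurable]: "K \<in> sets lebesgue" if "K \<in> children k J" for K
    using J_fam_measurable[OF children_J_fam[OF J that]] .
  show ?thesis
    unfolding weight_of_def pointwise by (simp add: nn_integral_add nn_integral_sum)
qed

text \<open>The \<open>3 ^ (k - 1) + 1\<close> summands in the preceding lemma are all equal.\<close>

lemma weight_J: "J \<in> J_fam k (Suc l) \<Longrightarrow> weight_of w J = ennreal (1 / (3 ^ (k - 1) + 1) ^ l)"
proof (induction l arbitrary: J)
  case 0
  \<comment> \<open>The total mass is prescribed on the closed unit interval, whereas the root is half-open.\<close>
  have "w 1 = 0"
  proof (rule ccontr)
    assume "w 1 \<noteq> 0"
    then obtain i where "1 \<in> Omega k P (Suc i)" using w_support by blast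
    then show False using Omega_in_earlier_J[of 1 i 0] by auto
  qed
  then have "ennreal (w x) * indicator {0..<1} x = ennreal (w x) * indicator {0..1} x" for x
    by (cases "x = 1") (auto simp: indicator_def)
  then show ?case using 0 weight_unit by (simp add: weight_of_def)
next
  case (Suc l)
  then obtain J' where J': "J' \<in> J_fam k (Suc l)" "J \<in> children k J'"
    by (auto simp: J_fam_children)
  define M :: real where "M = 3 ^ (k - 1) + 1"
  have M: "M > 0" by (simp add: M_def add_pos_pos)
  have "weight_of w K = weight_of w J" if "K \<in> children k J'" for K
    using weight_P_eq_weight_child[OF J'(1)] that J'(2) by metis
  then have "weight_of w J' = weight_of w J + of_nat (3 ^ (k - 1)) * weight_of w J"
    using weight_split[OF J'(1)] weight_P_eq_weight_child[OF J'] card_children[OF J'(1)] by simp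
  also have "\<dots> = ennreal M * weight_of w J"
  proof -
    have "ennreal M = of_nat (3 ^ (k - 1)) + 1"
      unfolding M_def ennreal_of_nat_eq_real_of_nat by (subst ennreal_plus) auto
    then show ?thesis by (simp add: distrib_right add.commute)
  qed
  finally have eq: "ennreal M * weight_of w J = ennreal (1 / M ^ l)"
    using Suc.IH[OF J'(1)] by (simp add: M_def)
  \<comment> \<open>An infinite mass of \<open>J\<close> is excluded since the mass of its parent is finite.\<close>
  show ?case
  proof (cases "weight_of w J")
    case (real v)
    then have "ennreal (M * v) = ennreal (1 / M ^ l)" using eq M by (simp add: ennreal_mult)
    then have "M * v = 1 / M ^ l" using M real by (simp add: ennreal_inj)
    then have "v = 1 / M ^ Suc l" using M by (simp add: field_simps)
    then show ?thesis using real by (simp add: M_def)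
  next
    case top
    then show ?thesis using eq M by (simp add: ennreal_mult_top)
  qed
qed

text \<open>The factor by which the mean of \<open>w\<close> grows from an interval to any of its children.\<close>

definition \<alpha> :: real where "\<alpha> = 3 ^ k / (3 ^ (k - 1) + 1)"

lemma w_Omega:
  assumes "x \<in> Omega k P (Suc l)"
  shows "w x = \<alpha> ^ Suc l"
proof -
  have "w constant_on Omega k P (Suc l)" using weight unfolding is_weight_def by simp
  then obtain c where c: "\<And>y. y \<in> Omega k P (Suc l) \<Longrightarrow> w y = c"
    unfolding constant_on_def by blast
  have "c \<ge> 0" using c[OF assms] w_nonneg[of x] by simp
  obtain J where J: "J \<in> J_fam k (Suc l)" "x \<in> P J" using assms by (auto simp: Omega_mem)
  obtain n where n: "P J = cell (Suc l * k) n" using P_cell(1)[OF J(1)] by blast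
  have "children k J \<noteq> {}" using card_children[OF J(1)] by auto
  then obtain K where K: "K \<in> children k J" by blast
  have "ennreal (w y) * indicator (P J) y = ennreal c * indicator (P J) y" for y
    using c[of y] J(1) by (auto simp: indicator_def Omega_mem)
  then have "weight_of w (P J) = ennreal c * emeasure lebesgue (P J)"
    by (simp add: weight_of_def nn_integral_cmult_indicator n)
  also have "\<dots> = ennreal (c / 3 ^ (Suc l * k))"
    using ennreal_mult[OF \<open>c \<ge> 0\<close>, of "1 / 3 ^ (Suc l * k)"] by (simp add: n emeasure_cell)
  finally have "ennreal (c / 3 ^ (Suc l * k)) = ennreal (1 / (3 ^ (k - 1) + 1) ^ Suc l)"
    using weight_P_eq_weight_child[OF J(1) K] weight_J[OF children_J_fam[OF J(1) K]] by simp
  then have "c / 3 ^ (Suc l * k) = 1 / (3 ^ (k - 1) + 1) ^ Suc l"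
    using \<open>c \<ge> 0\<close> by (subst (asm) ennreal_inj) (auto intro: add_nonneg_nonneg)
  then have "c = 3 ^ (Suc l * k) / (3 ^ (k - 1) + 1) ^ Suc l"
    by (simp only: divide_eq_eq) simp
  also have "\<dots> = \<alpha> ^ Suc l"
    unfolding \<alpha>_def power_divide by (simp only: mult.commute[of "Suc l"] power_mult)
  finally show ?thesis using c[OF assms] by simp
qed

section \<open>Integrals of the power of the weight\<close>

definition r :: real where "r = 1 + 1 / 3 ^ (k + 1)"

text \<open>The ratio of the values of \<open>w powr r\<close> on consecutive sets \<open>\<Omega>\<^sub>l\<close>, \<open>\<Omega>\<^sub>l\<^sub>+\<^sub>1\<close>.\<close>

definition \<beta> :: real where "\<beta> = \<alpha> powr r"

lemma r_ge_1: "r \<ge> 1"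
  by (simp add: r_def)

lemma alpha_eq: "\<alpha> = 3 * 3 ^ k / (3 ^ k + 3)"
proof -
  have "(3::real) ^ k = 3 * 3 ^ (k - 1)" using k by (cases k) auto
  moreover have "3 * x / (x + 1) = 3 * (3 * x) / (3 * x + 3)" if "x > 0" for x :: real
    using that by (simp add: field_simps)
  ultimately show ?thesis unfolding \<alpha>_def by simp
qed

lemma alpha_bounds: "1 \<le> \<alpha>" "\<alpha> \<le> 3"
proof -
  have "(3::real) ^ 1 \<le> 3 ^ k" using k by (intro power_increasing) auto
  then have "(3::real) \<le> 3 ^ k" by simp
  then show "1 \<le> \<alpha>" "\<alpha> \<le> 3" unfolding alpha_eq by (auto simp: le_divide_eq divide_le_eq)
qed

lemma beta_ge_1: "\<beta> \<ge> 1"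
  unfolding \<beta>_def using alpha_bounds(1) r_ge_1 by (intro ge_one_powr_ge_zero) auto

text \<open>With \<open>t = 3 ^ k\<close> one has \<open>\<alpha> = 3 t / (t + 3)\<close> and \<open>r - 1 = 1 / (3 t)\<close>. As \<open>\<alpha> \<le> 3\<close>, Bernoulli's
  inequality bounds \<open>\<alpha> powr (r - 1)\<close> by \<open>1 + 2 / (3 t)\<close>, which leaves
  \<open>\<beta> \<le> (3 t + 2) / (t + 3)\<close>. The choice of \<open>r\<close> serves to keep the
  gap below \<open>3\<close> of order \<open>1 / t\<close>.\<close>

lemma beta_le: "\<beta> \<le> 3 - 7 / (3 ^ k + 3)"
proof -
  define t :: real where "t = 3 ^ k"
  define n :: nat where "n = 3 ^ (k + 1)"
  have t: "t > 0" and n: "n > 0" and nt: "real n = 3 * t" by (auto simp: t_def n_def)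
  have "3 = 1 + real n * (2 / real n)" using n by simp
  also have "\<dots> \<le> (1 + 2 / real n) ^ n"
    by (rule Bernoulli_inequality) (simp add: order_trans[of _ 0])
  finally have three: "3 \<le> (1 + 2 / real n) ^ n" .
  have "\<alpha> powr (1 / real n) \<le> ((1 + 2 / real n) ^ n) powr (1 / real n)"
    using alpha_bounds three by (intro powr_mono2) auto
  also have "\<dots> = ((1 + 2 / real n) powr real n) powr (1 / real n)"
    by (subst powr_realpow) (auto intro: add_pos_nonneg)
  also have "\<dots> = 1 + 2 / real n"
    using n by (simp add: powr_powr add_nonneg_nonneg)
  finally have "\<alpha> powr (1 / real n) \<le> 1 + 2 / real n" .
  then have "\<alpha> * \<alpha> powr (1 / real n) \<le> \<alpha> * (1 + 2 / real n)"
    using alpha_bounds by (intro mult_left_mono) auto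
  also have "\<dots> = 3 - 7 / (t + 3)"
  proof -
    have "\<alpha> * (1 + 2 / real n) = (3 * t + 2) / (t + 3)"
    proof -
      have "1 + 2 / real n = (3 * t + 2) / (3 * t)" using t by (simp add: nt field_simps)
      then show ?thesis unfolding alpha_eq t_def[symmetric] using t by simp
    qed
    also have "\<dots> = 3 - 7 / (t + 3)" using t by (simp add: field_simps)
    finally show ?thesis .
  qed
  finally show ?thesis
    unfolding \<beta>_def r_def powr_add using alpha_bounds by (simp add: n_def t_def)
qed

lemma beta_less_3: "\<beta> < 3"
proof -
  have "0 < 7 / (3 ^ k + 3 :: real)" by (simp add: add_pos_pos)
  then show ?thesis using beta_le by linarith
qed

lemma geometric_series_beta_le: "1 / (1 - \<beta> / 3) \<le> 6 / 7 * 3 ^ k"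
proof -
  have "(3::real) ^ 1 \<le> 3 ^ k" using k by (intro power_increasing) auto
  then have t: "(3::real) \<le> 3 ^ k" by simp
  have "x / 3 \<le> 1 - \<beta> / 3" if "\<beta> \<le> 3 - x" for x
    using that by linarith
  from this[OF beta_le] have "7 / (3 * (3 ^ k + 3)) \<le> 1 - \<beta> / 3"
    by (simp only: divide_divide_eq_left mult.commute[of 3])
  then have "1 / (1 - \<beta> / 3) \<le> 1 / (7 / (3 * (3 ^ k + 3)))"
    by (intro divide_left_mono mult_pos_pos) (use beta_less_3 in \<open>auto simp: add_pos_pos\<close>)
  also have "\<dots> \<le> 6 / 7 * 3 ^ k" using t by simp
  finally show ?thesis .
qed

lemma alpha_power_powr: "(\<alpha> ^ n) powr r = \<beta> ^ n"
proof -
  have "(\<alpha> ^ n) powr r = (\<alpha> powr real n) powr r" using alpha_bounds by (simp add: powr_realpow)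
  also have "\<dots> = (\<alpha> powr r) powr real n" by (simp add: powr_powr mult.commute)
  also have "\<dots> = \<beta> ^ n" using alpha_bounds unfolding \<beta>_def by (subst powr_realpow) auto
  finally show ?thesis .
qed

lemma w_powr_Omega: "x \<in> Omega k P (Suc l) \<Longrightarrow> w x powr r = \<beta> ^ Suc l"
  using w_Omega alpha_power_powr by metis

lemma w_powr_measurable [measurable]: "(\<lambda>y. ennreal (w y powr r)) \<in> borel_measurable lebesgue"
  by measurable

text \<open>Inside \<open>K\<close> the function \<open>w powr r\<close> lives on the sets \<open>\<Omega>\<^sub>m\<^sub>+\<^sub>j\<^sub>+\<^sub>1 \<inter> K\<close>, where it has the
  values \<open>\<beta> ^ (m + j + 1)\<close> and whose measures decay like \<open>(1 / 3) ^ j\<close>. The sum \<open>1 / (1 - \<beta> / 3)\<close> of the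
  geometric series is at most \<open>6 / 7 * 3 ^ k\<close>; the factor \<open>3 ^ k\<close> turns \<open>|P K|\<close> into \<open>|K|\<close>.\<close>

lemma w_powr_integral_J:
  assumes K: "K \<in> J_fam k (Suc m)"
  shows "(\<integral>\<^sup>+y\<in>K. ennreal (w y powr r) \<partial>lebesgue) \<le> ennreal (6 / 7 * \<beta> ^ Suc m / 3 ^ (m * k))"
proof -
  have [measurable]: "K \<in> sets lebesgue" using J_fam_measurable[OF K] .
  have "ennreal (w y powr r) * indicator K y \<le>
      (\<Sum>j. ennreal (\<beta> ^ Suc (m + j)) * indicator (Omega k P (Suc (m + j)) \<inter> K) y)" for y
  proof (cases "y \<in> K \<and> w y \<noteq> 0")
    case True
    then obtain i where i: "y \<in> Omega k P (Suc i)" using w_support by blast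
    then have "m \<le> i" using earlier_Omega_Int_J_empty[OF K, of i] True by force
    then obtain j where j: "i = m + j" using le_Suc_ex by blast
    have "ennreal (w y powr r) * indicator K y =
        (\<Sum>j\<in>{j}. ennreal (\<beta> ^ Suc (m + j)) * indicator (Omega k P (Suc (m + j)) \<inter> K) y)"
      using True i w_powr_Omega[OF i] by (simp add: j)
    also have "\<dots> \<le> (\<Sum>j. ennreal (\<beta> ^ Suc (m + j)) * indicator (Omega k P (Suc (m + j)) \<inter> K) y)"
      by (intro sum_le_suminf) auto
    finally show ?thesis .
  qed auto
  then have "(\<integral>\<^sup>+y\<in>K. ennreal (w y powr r) \<partial>lebesgue) \<le>
      (\<integral>\<^sup>+y. (\<Sum>j. ennreal (\<beta> ^ Suc (m + j)) * indicator (Omega k P (Suc (m + j)) \<inter> K) y) \<partial>lebesgue)"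
    by (intro nn_integral_mono)
  also have "\<dots> = (\<Sum>j. \<integral>\<^sup>+y. ennreal (\<beta> ^ Suc (m + j)) * indicator (Omega k P (Suc (m + j)) \<inter> K) y \<partial>lebesgue)"
    by (intro nn_integral_suminf) measurable
  also have "\<dots> = (\<Sum>j. ennreal (\<beta> ^ Suc (m + j)) * emeasure lebesgue (Omega k P (Suc (m + j)) \<inter> K))"
    by (intro suminf_cong nn_integral_cmult_indicator) measurable
  also have "\<dots> \<le> (\<Sum>j. ennreal (\<beta> ^ Suc m / 3 ^ (Suc m * k) * (\<beta> / 3) ^ j))"
  proof (intro suminf_le)
    fix j
    have "ennreal (\<beta> ^ Suc (m + j)) * emeasure lebesgue (Omega k P (Suc (m + j)) \<inter> K)
        \<le> ennreal (\<beta> ^ Suc (m + j)) * ennreal ((1 / 3) ^ j / 3 ^ (Suc m * k))"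
      using emeasure_Omega_Int_J_le[OF K] by (intro mult_left_mono) auto
    also have "\<dots> = ennreal (\<beta> ^ Suc (m + j) * ((1 / 3) ^ j / 3 ^ (Suc m * k)))"
      using beta_ge_1 by (intro ennreal_mult[symmetric]) auto
    also have "\<beta> ^ Suc (m + j) * ((1 / 3) ^ j / 3 ^ (Suc m * k)) = \<beta> ^ Suc m / 3 ^ (Suc m * k) * (\<beta> / 3) ^ j"
      by (simp add: power_divide power_add ac_simps)
    finally show "ennreal (\<beta> ^ Suc (m + j)) * emeasure lebesgue (Omega k P (Suc (m + j)) \<inter> K)
        \<le> ennreal (\<beta> ^ Suc m / 3 ^ (Suc m * k) * (\<beta> / 3) ^ j)" .
  qed auto
  also have "\<dots> = ennreal (\<beta> ^ Suc m / 3 ^ (Suc m * k) * (1 / (1 - \<beta> / 3)))"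
    using beta_ge_1 beta_less_3 by (intro suminf_ennreal_eq sums_mult geometric_sums) auto
  also have "\<dots> \<le> ennreal (\<beta> ^ Suc m / 3 ^ (Suc m * k) * (6 / 7 * 3 ^ k))"
    using geometric_series_beta_le beta_ge_1 by (intro ennreal_leI mult_left_mono) auto
  also have "\<beta> ^ Suc m / 3 ^ (Suc m * k) * (6 / 7 * 3 ^ k) = 6 / 7 * \<beta> ^ Suc m / 3 ^ (m * k)"
    by (simp add: power_add)
  finally show ?thesis .
qed

lemma w_powr_le_off_J:
  assumes "\<And>J. J \<in> J_fam k (Suc (Suc l)) \<Longrightarrow> y \<notin> J"
  shows "w y powr r \<le> \<beta> ^ Suc l"
proof (cases "w y = 0")
  case False
  then obtain i where i: "y \<in> Omega k P (Suc i)" using w_support by blast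
  have "i \<le> l" using Omega_in_earlier_J[OF i, of "Suc l"] assms by force
  then show ?thesis
    unfolding w_powr_Omega[OF i] using beta_ge_1 by (intro power_increasing) auto
qed (use beta_ge_1 in auto)

text \<open>The intervals of generation \<open>l + 2\<close> that meet \<open>R\<close> have length \<open>h = 3 ^ (- (l + 1) k)\<close> and
  total length at most \<open>|R| + 2 h \<le> 7 |R|\<close>. They contribute at most
  \<open>7 * 6 / 7 * \<beta> ^ (l + 2) * |R| \<le> 18 * \<beta> ^ (l + 1) * |R|\<close>, and the rest of \<open>R\<close> at most
  \<open>\<beta> ^ (l + 1) * |R|\<close>.\<close>

lemma w_powr_integral_long_interval:
  assumes R: "is_interval R" "R \<in> lmeasurable" and long: "1 / 3 ^ (Suc l * k) / 3 \<le> len R"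
  shows "(\<integral>\<^sup>+y\<in>R. ennreal (w y powr r) \<partial>lebesgue) \<le> ennreal (21 * \<beta> ^ Suc l * len R)"
proof -
  have [measurable]: "R \<in> sets lebesgue" using R(2) by auto
  define h :: real where "h = 1 / 3 ^ (Suc l * k)"
  define F where "F = {K \<in> J_fam k (Suc (Suc l)). K \<inter> R \<noteq> {}}"
  have F: "finite F" "F \<subseteq> J_fam k (Suc (Suc l))" using finite_J_fam by (auto simp: F_def)
  have [measurable]: "K \<in> sets lebesgue" if "K \<in> F" for K
    using J_fam_measurable F(2) that by blast
  have "ennreal (w y powr r) * indicator R y \<le>
      ennreal (\<beta> ^ Suc l) * indicator R y + (\<Sum>K\<in>F. ennreal (w y powr r) * indicator K y)" for y
  proof (cases "\<exists>K \<in> F. y \<in> K")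
    case True
    then obtain K where K: "K \<in> F" "y \<in> K" by blast
    have "ennreal (w y powr r) * indicator R y \<le> ennreal (w y powr r) * indicator K y"
      using K by (auto simp: indicator_def)
    also have "\<dots> \<le> (\<Sum>K\<in>F. ennreal (w y powr r) * indicator K y)"
      using K F(1) by (intro member_le_sum) auto
    finally show ?thesis by (simp add: add_increasing)
  next
    case False
    then have "ennreal (w y powr r) * indicator R y \<le> ennreal (\<beta> ^ Suc l) * indicator R y"
      using w_powr_le_off_J[of l y] by (auto simp: F_def indicator_def intro!: ennreal_leI)
    then show ?thesis by (simp add: add_increasing2)
  qed
  then have "(\<integral>\<^sup>+y\<in>R. ennreal (w y powr r) \<partial>lebesgue) \<le>
      (\<integral>\<^sup>+y. ennreal (\<beta> ^ Suc l) * indicator R y + (\<Sum>K\<in>F. ennreal (w y powr r) * indicator K y) \<partial>lebesgue)"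
    by (intro nn_integral_mono)
  also have "\<dots> = ennreal (\<beta> ^ Suc l) * emeasure lebesgue R
      + (\<Sum>K\<in>F. \<integral>\<^sup>+y\<in>K. ennreal (w y powr r) \<partial>lebesgue)"
    by (simp add: nn_integral_add nn_integral_sum nn_integral_cmult_indicator)
  also have "\<dots> \<le> ennreal (\<beta> ^ Suc l) * emeasure lebesgue R
      + (\<Sum>K\<in>F. ennreal (6 / 7 * \<beta> ^ Suc (Suc l) * h))"
  proof (intro add_left_mono sum_mono)
    fix K assume "K \<in> F"
    then have "K \<in> J_fam k (Suc (Suc l))" using F(2) by blast
    from w_powr_integral_J[OF this]
    show "(\<integral>\<^sup>+y\<in>K. ennreal (w y powr r) \<partial>lebesgue) \<le> ennreal (6 / 7 * \<beta> ^ Suc (Suc l) * h)"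
      by (simp add: h_def)
  qed
  also have "\<dots> = ennreal (\<beta> ^ Suc l * len R + 6 / 7 * \<beta> ^ Suc (Suc l) * (real (card F) * h))"
    using beta_ge_1 R(2)
    by (simp add: len_def emeasure_eq_measure2 ennreal_of_nat_eq_real_of_nat h_def ac_simps
        flip: ennreal_mult ennreal_plus)
  also have "\<dots> \<le> ennreal (21 * \<beta> ^ Suc l * len R)"
  proof (rule ennreal_leI)
    define S where "S = {n. cell (Suc l * k) n \<in> F}"
    have FS: "F = cell (Suc l * k) ` S"
      using J_fam_cell F(2) unfolding S_def by blast
    have "inj_on (cell (Suc l * k)) S" using inj_cell inj_on_subset by blast
    then have "finite S" "card F = card S"
      using F(1) unfolding FS by (auto simp: finite_image_iff card_image)
    then have "real (card F) * h \<le> len R + 2 * h"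
      using card_cells_meeting_interval[of S R "Suc l * k"] R by (auto simp: S_def F_def h_def)
    also have "\<dots> \<le> 7 * len R" using long by (simp add: h_def)
    finally have "\<beta> * (real (card F) * h) \<le> 3 * (7 * len R)"
      by (rule mult_mono[OF less_imp_le[OF beta_less_3]]) (simp_all add: h_def)
    then have "\<beta> ^ Suc l * (\<beta> * (real (card F) * h)) \<le> \<beta> ^ Suc l * (3 * (7 * len R))"
      using beta_ge_1 by (intro mult_left_mono) auto
    moreover have "0 \<le> \<beta> ^ Suc l * len R" using beta_ge_1 by (simp add: len_def)
    ultimately show "\<beta> ^ Suc l * len R + 6 / 7 * \<beta> ^ Suc (Suc l) * (real (card F) * h)
        \<le> 21 * \<beta> ^ Suc l * len R"
      by (simp add: algebra_simps)
  qed
  finally show ?thesis .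
qed

text \<open>The distance of \<open>x\<close> from the complement of \<open>I\<close> is at least \<open>|I| / 3\<close>, so an interval
  \<open>R\<close> through \<open>x\<close> either stays in \<open>I\<close> or is long enough for the preceding lemma.\<close>

lemma w_powr_integral_interval_through_middle_third:
  assumes I: "I \<in> I_fam k P (Suc l)" and x: "x \<in> middle_third I" "x \<in> R"
    and R: "is_interval R" "R \<in> lmeasurable"
  shows "(\<integral>\<^sup>+y\<in>R. ennreal (w y powr r) \<partial>lebesgue) \<le> ennreal (21 * \<beta> ^ Suc l * len R)"
proof (cases "R \<subseteq> I")
  case True
  have "I \<subseteq> Omega k P (Suc l)" using I by (auto simp: Omega_def)
  then have "ennreal (w y powr r) * indicator R y = ennreal (\<beta> ^ Suc l) * indicator R y" for y
    using True w_powr_Omega by (auto simp: indicator_def)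
  then have "(\<integral>\<^sup>+y\<in>R. ennreal (w y powr r) \<partial>lebesgue) = ennreal (\<beta> ^ Suc l) * emeasure lebesgue R"
    using R(2) by (simp add: nn_integral_cmult_indicator fmeasurableD)
  also have "\<dots> = ennreal (\<beta> ^ Suc l * len R)"
    using R(2) beta_ge_1 by (simp add: len_def emeasure_eq_measure2 ennreal_mult)
  also have "\<dots> \<le> ennreal (21 * \<beta> ^ Suc l * len R)"
    using beta_ge_1 by (intro ennreal_leI mult_right_mono) (auto simp: len_def)
  finally show ?thesis .
next
  case False
  then obtain y where y: "y \<in> R" "y \<notin> I" by blast
  define N where "N = Suc l * k"
  obtain n where n: "I = cell N n" using I P_cell(1) unfolding I_fam_def N_def by blast
  have "(3 * of_int n + 1) / 3 ^ N / 3 \<le> x" "x < (3 * of_int n + 2) / 3 ^ N / 3"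
    using x(1) unfolding n middle_third_cell by (auto simp: cell_def mult.commute add.commute)
  moreover have "y < of_int n / 3 ^ N \<or> (of_int n + 1) / 3 ^ N \<le> y"
    using y(2) unfolding n cell_def by auto
  ultimately have dist: "1 / 3 ^ N / 3 \<le> \<bar>x - y\<bar>"
    by (auto simp: add_divide_distrib)
  then have "1 / 3 ^ N / 3 \<le> len R"
    using diff_le_len[OF R x(2) y(1)] diff_le_len[OF R y(1) x(2)] by linarith
  then show ?thesis using w_powr_integral_long_interval[OF R] by (simp add: N_def)
qed

end

section \<open>The maximal function\<close>

lemma ennreal_powr_mono:
  assumes "u \<le> ennreal v" "0 \<le> v" "0 \<le> p"
  shows "ennreal_powr u p \<le> ennreal (v powr p)"
proof (cases u)
  case (real t)
  then show ?thesis
    using assms by (auto simp: ennreal_powr_def intro!: ennreal_leI powr_mono2)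
next
  case top
  then show ?thesis using assms(1) by (simp add: top_unique)
qed

theorem lemma2p2:
  shows "\<exists>k0 :: nat. \<forall>k \<ge> k0. \<forall>(P :: real set \<Rightarrow> real set) (w :: real \<Rightarrow> real) (r :: real).
    admissible_choice k P \<and> is_weight k P w \<and> r = 1 + 1 / 3 ^ (k + 1) \<longrightarrow>
    (\<forall>l \<ge> 1. \<forall>I \<in> I_fam k P l. \<forall>x \<in> middle_third I.
       maximal_fn r w x \<le> 21 * ennreal (w x))"
proof (intro exI[of _ 1] allI impI ballI)
  fix k :: nat and P :: "real set \<Rightarrow> real set" and w :: "real \<Rightarrow> real" and r :: real
    and l :: nat and I x
  assume "1 \<le> k" and hyp: "admissible_choice k P \<and> is_weight k P w \<and> r = 1 + 1 / 3 ^ (k + 1)"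
    and "1 \<le> l" and I: "I \<in> I_fam k P l" and x: "x \<in> middle_third I"
  interpret T: triadic_weight k P w
    using \<open>1 \<le> k\<close> hyp by unfold_locales auto
  have r: "r = T.r" using hyp by (simp add: T.r_def)
  obtain m where m: "l = Suc m" using \<open>1 \<le> l\<close> by (cases l) auto
  obtain J where J: "J \<in> J_fam k (Suc m)" "I = P J" using I by (auto simp: I_fam_def m)
  obtain n where "I = cell (Suc m * k) n" using T.P_cell(1)[OF J(1)] J(2) by blast
  then have "x \<in> I"
    using x cell_subset_iff[of "Suc m * k" 1 "3 * n + 1" n] by (auto simp: middle_third_cell)
  then have "x \<in> Omega k P (Suc m)" using I by (auto simp: Omega_def m)
  then have wx: "w x powr r = T.\<beta> ^ Suc m" using T.w_powr_Omega r by simp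
  have "ennreal_powr ((\<integral>\<^sup>+y\<in>R. ennreal (\<bar>w y\<bar> powr r) \<partial>lebesgue) / ennreal (len R)) (1 / r)
      \<le> 21 * ennreal (w x)"
    if R: "is_interval R" "bounded R" "0 < len R" "x \<in> R" for R
  proof -
    have "R \<in> lmeasurable" using R by (simp add: is_interval_convex measurable_convex)
    then have "(\<integral>\<^sup>+y\<in>R. ennreal (\<bar>w y\<bar> powr r) \<partial>lebesgue) \<le> ennreal (21 * w x powr r * len R)"
      using T.w_powr_integral_interval_through_middle_third[of I m x R] I x R
      by (simp only: m wx) (simp add: r T.w_nonneg)
    then have "(\<integral>\<^sup>+y\<in>R. ennreal (\<bar>w y\<bar> powr r) \<partial>lebesgue) / ennreal (len R)
        \<le> ennreal (21 * w x powr r * len R) / ennreal (len R)"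
      by (rule divide_right_mono_ennreal)
    also have "\<dots> = ennreal (21 * w x powr r)"
      using R(3) by (subst divide_ennreal) auto
    finally have "ennreal_powr ((\<integral>\<^sup>+y\<in>R. ennreal (\<bar>w y\<bar> powr r) \<partial>lebesgue) / ennreal (len R)) (1 / r)
        \<le> ennreal ((21 * w x powr r) powr (1 / r))"
      using T.r_ge_1 r by (intro ennreal_powr_mono) auto
    also have "(21 * w x powr r) powr (1 / r) = 21 powr (1 / r) * w x"
      using T.r_ge_1 T.w_nonneg[of x] r by (simp add: powr_mult powr_powr)
    \<comment> \<open>The constant bounds the mean of \<open>w powr r\<close>; the root only improves it, because \<open>21 \<ge> 1\<close>.\<close>
    also have "\<dots> \<le> 21 powr 1 * w x"
      using T.r_ge_1 T.w_nonneg[of x] r by (intro mult_right_mono powr_mono) auto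
    finally show ?thesis by (simp add: ennreal_mult' ennreal_leI)
  qed
  then show "maximal_fn r w x \<le> 21 * ennreal (w x)"
    unfolding maximal_fn_def by (intro SUP_least) auto
qed

end
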